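(* Let $1\le r<n$ and let $A\in\mathbb{R}^{n\times n}$ be symmetric with eigenvalue decomposition $A=V\Lambda V^{T}+V_\perp\Lambda_\perp V_\perp^{T}$, where $[V\; V_\perp]$ is orthogonal, $V\in\mathbb{R}^{n\times r}$, $V_\perp\in\mathbb{R}^{n\times(n-r)}$, $\Lambda=\mathrm{diag}(\lambda_1,\dots,\lambda_r)$, $\Lambda_\perp=\mathrm{diag}(\lambda_{r+1},\dots,\lambda_n)$, $\lambda_1\ge\dots\ge\lambda_r>\lambda_{r+1}\ge\dots\ge\lambda_n$, and $\min_{k\le r}|\lambda_k|>\max_{k>r}|\lambda_k|$. Let $\mu$ be the coherence of $V$. Suppose there is a constant $C$ such that $$\|V_\perp\Lambda_\perp^{t}V_\perp^{T}\|_\infty\le C\,\lambda_{r+1}^{t}\,\|V_\perp V_\perp^{T}\|_\infty\qquad\text{for all } t\in\mathbb{N}.$$ Let $Q_0\in\mathbb{R}^{n\times r}$ have orthonormal columns, put $d_0:=\|Q_0^{T}V_\perp\|_2=\mathrm{dist}_2(Q_0,V)$, and assume $d_0<1$. Let $\{Q_t\}$ be the iterates of subspace iteration applied to $A$ with initial guess $Q_0$. Then for every $t\ge1$, $$\mathrm{dist}_{2\to\infty}(Q_t,V)\le\left(\frac{\lambda_{r+1}}{\lambda_r}\right)^{t}\left[\mu\sqrt{\frac{2r}{n}}\,\frac{d_0}{\sqrt{1-d_0^2}}+\frac{C(1+\mu\sqrt r)}{\sqrt{1-d_0^2}}\,\mathrm{dist}_{2\to\infty}(Q_0,V)\right].$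$
   Context: Norms: $\|\cdot\|_2$ is the spectral norm; $\|M\|_\infty=\max_i\|M_{i,:}\|_1$ (maximum absolute row sum); $\|M\|_{2\to\infty}=\max_i\|M_{i,:}\|_2$ (maximum Euclidean row norm). $\mathbb{O}_{n,r}$ is the set of $U\in\mathbb{R}^{n\times r}$ with $U^{T}U=I_r$, and $\mathbb{O}_r=\mathbb{O}_{r,r}$. For $U,W\in\mathbb{O}_{n,r}$: $\mathrm{dist}_2(U,W)=\|UU^{T}-WW^{T}\|_2$ and $\mathrm{dist}_{2\to\infty}(U,W)=\inf_{O\in\mathbb{O}_r}\|U-WO\|_{2\to\infty}$. Coherence: for $V\in\mathbb{O}_{n,r}$, the coherence of $V$ is the smallest $\mu>0$ with $\|V\|_{2\to\infty}\le\mu\sqrt{r/n}$. Subspace iteration: for $t=1,2,\dots$, set $V^{(t)}=AQ_{t-1}$ and compute a QR decomposition $V^{(t)}=Q_tR^{(t)}$ with $Q_t\in\mathbb{O}_{n,r}$ and $R^{(t)}\in\mathbb{R}^{r\times r}$ upper triangular. *)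

theory Defs
  imports "HOL-Analysis.Analysis"
begin

(* Matrices with n rows and r columns have type real^'r^'n, with n = CARD('n) and r = CARD('r).
   A column index type is linearly ordered whenever the order of the columns matters; its elements
   then stand for the indices 1 < 2 < ... in this order, so that Min UNIV and Max UNIV are the
   first and the last index. *)

definition spectral_norm :: "real^'m^'n \<Rightarrow> real" where
  "spectral_norm M = onorm ((*v) M)"

definition norm_inf :: "real^'m^'n \<Rightarrow> real" where
  "norm_inf M = Max (range (\<lambda>i. \<Sum>j\<in>UNIV. \<bar>M $ i $ j\<bar>))"

definition norm_2inf :: "real^'m^'n \<Rightarrow> real" where
  "norm_2inf M = Max (range (\<lambda>i. norm (row i M)))"

definition orthonormal_columns :: "(real^'r^'n) set" where
  "orthonormal_columns = {U. transpose U ** U = mat 1}"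

definition dist2 :: "real^'r^'n \<Rightarrow> real^'r^'n \<Rightarrow> real" where
  "dist2 U W = spectral_norm (U ** transpose U - W ** transpose W)"

definition dist_2inf :: "real^'r^'n \<Rightarrow> real^'r^'n \<Rightarrow> real" where
  "dist_2inf U W = (INF Z\<in>(orthonormal_columns :: (real^'r^'r) set). norm_2inf (U - W ** Z))"

(* The least element exists for V with orthonormal columns, since then V is not 0. *)
definition coherence :: "real^'r^'n \<Rightarrow> real" where
  "coherence V =
    (LEAST \<mu>. \<mu> > 0 \<and> norm_2inf V \<le> \<mu> * sqrt (real CARD('r) / real CARD('n)))"

definition diag_matrix :: "('k \<Rightarrow> real) \<Rightarrow> real^'k^'k" where
  "diag_matrix d = (\<chi> i j. if i = j then d i else 0)"

(* The operations * and ^ on type vec are componentwise, hence not the matrix ones. *)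
primrec matrix_power :: "real^'k^'k \<Rightarrow> nat \<Rightarrow> real^'k^'k" where
  "matrix_power M 0 = mat 1"
| "matrix_power M (Suc t) = M ** matrix_power M t"

definition hcat :: "real^'r^'n \<Rightarrow> real^'k^'n \<Rightarrow> real^('r + 'k)^'n" where
  "hcat V W = (\<chi> i j. case j of Inl a \<Rightarrow> V $ i $ a | Inr b \<Rightarrow> W $ i $ b)"

definition upper_triangular :: "real^('r::{finite,linorder})^('r::{finite,linorder}) \<Rightarrow> bool" where
  "upper_triangular R \<longleftrightarrow> (\<forall>i j. j < i \<longrightarrow> R $ i $ j = 0)"

definition qr_decomposition ::
  "real^('r::{finite,linorder})^'n \<Rightarrow> real^('r::{finite,linorder})^'n \<Rightarrow> real^('r::{finite,linorder})^('r::{finite,linorder}) \<Rightarrow> bool" where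
  "qr_decomposition M Q R \<longleftrightarrow> Q \<in> orthonormal_columns \<and> upper_triangular R \<and> M = Q ** R"

(* QR decompositions are not unique (signs); any choice in each step is allowed. *)
definition subspace_iteration ::
  "real^'n^'n \<Rightarrow> real^('r::{finite,linorder})^'n \<Rightarrow> (nat \<Rightarrow> real^('r::{finite,linorder})^'n) \<Rightarrow> bool" where
  "subspace_iteration A Q0 Q \<longleftrightarrow>
    Q 0 = Q0 \<and> (\<forall>t\<ge>1. \<exists>R. qr_decomposition (A ** Q (t - 1)) (Q t) R)"

end

(* Write M = V^T Q_t and E = V_perp^T Q_t. Multiplying the QR steps together gives one matrix R with
   M R = Lambda^t V^T Q_0 and E R = Lambda_perp^t V_perp^T Q_0, so that
   |E x| <= (lambda_(r+1) / lambda_r)^t tan(theta_0) |M x| with sin(theta_0) = d_0.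
   As M^T M + E^T E = I, the polar factor Z of M satisfies |M - Z| <= |E|, and
   Q_t - V Z = V (M - Z) + V_perp E. The first summand is controlled by the coherence of V; the
   second equals (V_perp Lambda_perp^t V_perp^T) (Q_0 - V Z_0) R^(-1) for every Z_0, to which the
   hypothesis on the powers applies. That hypothesis also forces lambda_(r+1) >= 0 and
   |lambda_k| <= lambda_(r+1) for all k > r, since the maximal row sum dominates every |eigenvalue|. *)
theory Submission
  imports Defs
begin

text \<open>As a simp rule this would turn \<open>transpose M *v x\<close> into
  \<open>x v* M\<close>, on which \<open>matrix_vector_mul_assoc\<close> no longer acts.\<close>

declare transpose_matrix_vector [simp del]

section \<open>The norms\<close>

lemma inner_transpose_mult: "inner (transpose M *v x) y = inner x (M *v y)"
  for M :: "real^'m^'n"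
  by (simp add: transpose_matrix_vector dot_lmul_matrix)

lemma norm_mult_le_spectral_norm: "norm (M *v x) \<le> spectral_norm M * norm x"
  unfolding spectral_norm_def by (rule onorm) simp

lemma spectral_norm_nonneg: "0 \<le> spectral_norm M"
  unfolding spectral_norm_def by (rule onorm_pos_le) simp

lemma spectral_norm_le:
  "spectral_norm M \<le> b" if "0 \<le> b" "\<And>x. norm (M *v x) \<le> b * norm x"
  unfolding spectral_norm_def using that by (rule onorm_bound)

text \<open>|M^T y|^2 = <y, M M^T y> <= b |y| |M^T y| by Cauchy-Schwarz, and one factor |M^T y|
  cancels.\<close>

lemma norm_transpose_mult_le:
  fixes M :: "real^'m^'n"
  assumes "\<And>x. norm (M *v x) \<le> b * norm x"
  shows "norm (transpose M *v y) \<le> b * norm y"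
proof -
  let ?z = "transpose M *v y"
  have "(norm ?z)\<^sup>2 = inner y (M *v ?z)"
    by (simp add: power2_norm_eq_inner inner_transpose_mult)
  also have "\<dots> \<le> norm y * norm (M *v ?z)"
    by (rule norm_cauchy_schwarz)
  also have "\<dots> \<le> norm y * (b * norm ?z)"
    by (intro mult_left_mono assms) simp
  finally have "norm ?z * norm ?z \<le> (b * norm y) * norm ?z"
    by (simp add: power2_eq_square mult_ac)
  moreover have "norm ?z = 0 \<Longrightarrow> norm ?z \<le> b * norm y"
  proof -
    assume "norm ?z = 0"
    \<comment> \<open>No sign of \<open>b\<close> is assumed; the bound at any nonzero
      \<open>x\<close> supplies it.\<close>
    moreover have "0 \<le> b * norm y"
    proof (cases "\<exists>x :: real^'m. x \<noteq> 0 ")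
      case True
      then obtain x :: "real^'m" where "x \<noteq> 0" by blast
      with order_trans[OF norm_ge_zero assms[of x]] have "0 \<le> b"
        by (simp add: zero_le_mult_iff)
      then show ?thesis by simp
    next
      case False
      then have "axis (undefined :: 'm) 1 = (0 :: real^'m)" by blast
      then show ?thesis by simp
    qed
    ultimately show ?thesis by simp
  qed
  ultimately show ?thesis
    by (metis mult_right_le_imp_le norm_ge_zero order_le_less)
qed

lemma norm_row_le: "norm (row i M) \<le> norm_2inf M"
  unfolding norm_2inf_def by (rule Max_ge) auto

lemma norm_2inf_le: "norm_2inf M \<le> b" if "\<And>i. norm (row i M) \<le> b"
  unfolding norm_2inf_def using that by (subst Max_le_iff) auto

lemma norm_2inf_nonneg: "0 \<le> norm_2inf M"
  by (rule order_trans[OF norm_ge_zero norm_row_le])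

lemma row_l1_le: "(\<Sum>j\<in>UNIV. \<bar>M $ i $ j\<bar>) \<le> norm_inf M"
  unfolding norm_inf_def by (rule Max_ge) auto

lemma norm_inf_le: "norm_inf M \<le> b" if "\<And>i. (\<Sum>j\<in>UNIV. \<bar>M $ i $ j\<bar>) \<le> b"
  unfolding norm_inf_def using that by (subst Max_le_iff) auto

lemma norm_inf_nonneg: "0 \<le> norm_inf M"
  by (rule order_trans[OF _ row_l1_le]) (simp add: sum_nonneg)

lemma row_matrix_mult: "row i (X ** Y) = transpose Y *v row i X"
  for X :: "real^'m^'n"
  by (simp add: row_def matrix_matrix_mult_def transpose_def matrix_vector_mult_def vec_eq_iff mult.commute)

lemma row_add: "row i (X + Y) = row i X + row i Y"
  by (simp add: row_def vec_eq_iff)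

lemma norm_2inf_add: "norm_2inf (X + Y) \<le> norm_2inf X + norm_2inf Y"
  by (rule norm_2inf_le) 
    (auto simp: row_add intro!: order_trans[OF norm_triangle_ineq] add_mono norm_row_le)

text \<open>Each row of \<open>X ** Y\<close> is Y^T applied to a row of \<open>X\<close>, and Y^T
  obeys the same bound as \<open>Y\<close>.\<close>

lemma norm_2inf_mult_le:
  assumes "\<And>x. norm (Y *v x) \<le> b * norm x" "0 \<le> b"
  shows "norm_2inf (X ** Y) \<le> norm_2inf X * b"
proof (rule norm_2inf_le)
  fix i
  have "norm (row i (X ** Y)) \<le> b * norm (row i X)"
    unfolding row_matrix_mult by (rule norm_transpose_mult_le[OF assms(1)])
  also have "\<dots> \<le> b * norm_2inf X"
    using assms(2) by (intro mult_left_mono norm_row_le)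
  finally show "norm (row i (X ** Y)) \<le> norm_2inf X * b"
    by (simp add: mult.commute)
qed

lemma row_matrix_mult_sum: "row i (G ** X) = (\<Sum>j\<in>UNIV. G $ i $ j *\<^sub>R row j X)"
  for X :: "real^'m^'n"
  by (simp add: row_def matrix_matrix_mult_def vec_eq_iff)

text \<open>Each row of \<open>G ** X\<close> combines the rows of \<open>X\<close> with
  coefficients from a row of \<open>G\<close>. So a left factor costs a maximal absolute row sum,
  where a right factor costs only a spectral norm.\<close>

lemma norm_2inf_mult_le_norm_inf: "norm_2inf (G ** X) \<le> norm_inf G * norm_2inf X"
proof (rule norm_2inf_le)
  fix i
  have "norm (row i (G ** X)) \<le> (\<Sum>j\<in>UNIV. \<bar>G $ i $ j\<bar> * norm_2inf X)"
    unfolding row_matrix_mult_sum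
    by (rule order_trans[OF norm_sum]) (auto intro!: sum_mono mult_left_mono norm_row_le)
  also have "\<dots> \<le> norm_inf G * norm_2inf X"
    unfolding sum_distrib_right[symmetric] by (intro mult_right_mono row_l1_le norm_2inf_nonneg)
  finally show "norm (row i (G ** X)) \<le> norm_inf G * norm_2inf X" .
qed

text \<open>Evaluate the eigenvalue equation in a coordinate where |v| is largest and divide by that
  value.\<close>

lemma abs_eigenvalue_le_norm_inf:
  fixes M :: "real^'n^'n"
  assumes "M *v v = c *\<^sub>R v" "v \<noteq> 0"
  shows "\<bar>c\<bar> \<le> norm_inf M"
proof -
  define m where "m = Max (range (\<lambda>i. \<bar>v $ i\<bar>))"
  have "m \<in> range (\<lambda>i. \<bar>v $ i\<bar>)" unfolding m_def by (rule Max_in) auto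
  then obtain i where i: "m = \<bar>v $ i\<bar>" by auto
  have le: "\<bar>v $ j\<bar> \<le> m" for j unfolding m_def by (rule Max_ge) auto
  have "m > 0"
  proof (rule ccontr)
    assume "\<not> m > 0"
    with le have "\<bar>v $ j\<bar> \<le> 0" for j by (meson order_trans not_le)
    then have "v = 0" by (simp add: vec_eq_iff)
    with assms(2) show False ..
  qed
  have "\<bar>c\<bar> * m = \<bar>(M *v v) $ i\<bar>" using i assms(1) by (simp add: abs_mult)
  also have "\<dots> \<le> (\<Sum>j\<in>UNIV. \<bar>M $ i $ j\<bar> * \<bar>v $ j\<bar>)"
    unfolding matrix_vector_mult_def by (simp add: order_trans[OF sum_abs] abs_mult)
  also have "\<dots> \<le> (\<Sum>j\<in>UNIV. \<bar>M $ i $ j\<bar> * m)"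
    by (intro sum_mono mult_left_mono le) auto
  also have "\<dots> \<le> norm_inf M * m"
    unfolding sum_distrib_right[symmetric] using \<open>m > 0\<close> by (intro mult_right_mono row_l1_le) auto
  finally show ?thesis using \<open>m > 0\<close> by simp
qed

text \<open>The admissible values form a ray starting at \<open>norm_2inf V\<close> / sqrt (r / n).
  As \<open>V\<close> is nonzero, this endpoint is positive and hence admissible itself, so the
  defining inequality becomes an equality.\<close>

lemma norm_2inf_eq_coherence:
  fixes V :: "real^'r^'n"
  assumes "V \<noteq> 0"
  shows "norm_2inf V = coherence V * sqrt (real CARD('r) / real CARD('n))"
    and "0 < coherence V"
proof -
  let ?s = "sqrt (real CARD('r) / real CARD('n))"
  have s: "?s > 0" by simp
  have "norm_2inf V > 0"
  proof (rule ccontr)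
    assume "\<not> norm_2inf V > 0"
    then have "norm (row i V) \<le> 0" for i by (meson norm_row_le order_trans not_le)
    then have "V = 0" by (simp add: row_def vec_eq_iff)
    with assms show False ..
  qed
  then have "coherence V = norm_2inf V / ?s"
    unfolding coherence_def using s by (intro Least_equality) (auto simp: field_simps)
  with s \<open>norm_2inf V > 0\<close> show "norm_2inf V = coherence V * ?s" "0 < coherence V"
    by simp_all
qed

section \<open>The infimum over orthogonal matrices\<close>

lemma norm_2inf_bdd_below: "bdd_below ((\<lambda>Z. norm_2inf (U - W ** Z)) ` S)"
  by (rule bdd_belowI[of _ 0]) (auto simp: norm_2inf_nonneg)

lemma dist_2inf_le: "dist_2inf U W \<le> norm_2inf (U - W ** Z)" if "Z \<in> orthonormal_columns"
  unfolding dist_2inf_def using that by (intro cINF_lower norm_2inf_bdd_below)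

lemma mat_1_orthonormal: "mat 1 \<in> orthonormal_columns"
  by (simp add: orthonormal_columns_def)

lemma dist_2inf_greatest:
  fixes U W :: "real^'r^'n"
  assumes "\<And>Z :: real^'r^'r. Z \<in> orthonormal_columns \<Longrightarrow> b \<le> norm_2inf (U - W ** Z)"
  shows "b \<le> dist_2inf U W"
  unfolding dist_2inf_def using assms mat_1_orthonormal by (intro cINF_greatest) auto

lemma norm_orthonormal_mult: "norm (U *v x) = norm x" if "U \<in> orthonormal_columns"
proof -
  have "transpose U *v (U *v x) = x"
    using that by (simp add: orthonormal_columns_def matrix_vector_mul_assoc)
  then have "inner (U *v x) (U *v x) = inner x x"
    by (metis inner_transpose_mult)
  then show ?thesis by (simp add: norm_eq_sqrt_inner)
qed

section \<open>An orthogonal factor close to a contraction\<close>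

lemma matrix_diff_ldistrib: "A ** (B - C) = A ** B - A ** C" for A :: "real^'m^'n"
  by (simp add: matrix_eq matrix_vector_mul_assoc[symmetric] algebra_simps)

lemma matrix_diff_rdistrib: "(A - B) ** C = A ** C - B ** C" for A :: "real^'m^'n"
  by (simp add: matrix_eq matrix_vector_mul_assoc[symmetric] algebra_simps)

lemma transpose_add: "transpose (A + B) = transpose A + transpose B"
  by (simp add: transpose_def vec_eq_iff)

lemma transpose_diff: "transpose (A - B) = transpose A - transpose B"
  by (simp add: transpose_def vec_eq_iff)

(* I - Y is the square root of I - X when Y is a fixed point of Y \<mapsto> (X + Y^2) / 2,
   and this map preserves the symmetric matrices of norm at most s. *)
lemma ex_sqrt_one_minus:
  fixes X :: "real^'r^'r"
  assumes sym: "transpose X = X" and X: "\<And>x. norm (X *v x) \<le> s\<^sup>2 * norm x"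
    and s: "0 \<le> s" "s \<le> 1"
  obtains Y where "transpose Y = Y" "\<And>x. norm (Y *v x) \<le> s * norm x"
    "(mat 1 - Y) ** (mat 1 - Y) = mat 1 - X"
proof -
  \<comment> \<open>Brouwer's theorem will supply the fixed point: \<open>K\<close> is compact,
    convex and nonempty, and \<open>F\<close> maps it into itself.\<close>
  define K where "K = {Y :: real^'r^'r. transpose Y = Y \<and> (\<forall>x. norm (Y *v x) \<le> s * norm x)}"
  define F where "F Y = (1/2) *\<^sub>R (X + Y ** Y)" for Y :: "real^'r^'r"
  have cont_mv: "continuous_on S (\<lambda>Y :: real^'r^'r. Y *v x)" for S x
    unfolding matrix_vector_mult_def by (intro continuous_intros)
  have cont_tr: "continuous_on S (\<lambda>Y :: real^'r^'r. transpose Y)" for S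
    unfolding transpose_def by (intro continuous_intros)
  have "closed K"
    unfolding K_def by (intro closed_Collect_conj closed_Collect_all closed_Collect_le
        closed_Collect_eq continuous_intros cont_mv cont_tr)
  moreover have "bounded K"
  proof (rule boundedI)
    fix Y assume "Y \<in> K"
    then have "onorm ((*v) Y) \<le> s" using s by (auto simp: K_def intro: onorm_bound)
    then have entry: "\<bar>Y $ i $ j\<bar> \<le> s" for i j
      using matrix_component_le_onorm order_trans by blast
    have "norm Y \<le> (\<Sum>i\<in>UNIV. norm (Y $ i))"
      unfolding norm_vec_def by (rule L2_set_le_sum) simp
    also have "\<dots> \<le> (\<Sum>i\<in>(UNIV :: 'r set). \<Sum>j\<in>(UNIV :: 'r set). s)"
      by (intro sum_mono order_trans[OF norm_le_l1_cart]) (simp add: entry)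
    finally show "norm Y \<le> (\<Sum>i\<in>(UNIV :: 'r set). \<Sum>j\<in>(UNIV :: 'r set). s)" .
  qed
  ultimately have "compact K" by (simp add: compact_eq_bounded_closed)
  moreover have "convex K"
  proof (rule convexI)
    fix Y Z :: "real^'r^'r" and u v :: real
    assume YZ: "Y \<in> K" "Z \<in> K" and uv: "0 \<le> u" "0 \<le> v" "u + v = 1"
    have "norm ((u *\<^sub>R Y + v *\<^sub>R Z) *v x) \<le> s * norm x" for x
    proof -
      have "(u *\<^sub>R Y + v *\<^sub>R Z) *v x = u *\<^sub>R (Y *v x) + v *\<^sub>R (Z *v x)"
        by (simp add: algebra_simps scaleR_matrix_vector_assoc)
      also have "norm \<dots> \<le> u * norm (Y *v x) + v * norm (Z *v x)"
        using uv by (intro norm_triangle_le) simp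
      also have "\<dots> \<le> u * (s * norm x) + v * (s * norm x)"
        using YZ uv by (intro add_mono mult_left_mono) (auto simp: K_def)
      also have "\<dots> = s * norm x" using uv by (metis distrib_right mult_1)
      finally show ?thesis .
    qed
    with YZ show "u *\<^sub>R Y + v *\<^sub>R Z \<in> K"
      by (simp add: K_def transpose_add transpose_scalar)
  qed
  moreover have "0 \<in> K" using s by (simp add: K_def transpose_def vec_eq_iff)
  then have "K \<noteq> {}" by blast
  moreover have "continuous_on K F"
    unfolding F_def matrix_matrix_mult_def by (intro continuous_intros)
  moreover have "F Y \<in> K" if "Y \<in> K" for Y
  proof -
    have "norm (F Y *v x) \<le> s * norm x" for x
    proof -
      have Y: "norm (Y *v x) \<le> s * norm x" for x using that by (simp add: K_def)
      have "norm (Y *v (Y *v x)) \<le> s * (s * norm x)"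
        by (rule order_trans[OF Y mult_left_mono[OF Y s(1)]])
      \<comment> \<open>The two terms add up to at most 2 s^2 |x|; the factor 1/2 in
        \<open>F\<close> leaves s^2 |x|, and s <= 1 turns this into s |x|.\<close>
      with X[of x] have "norm (X *v x + Y *v (Y *v x)) \<le> 2 * (s\<^sup>2 * norm x)"
        by (intro norm_triangle_le) (simp add: power2_eq_square mult_ac)
      moreover have "F Y *v x = (1/2) *\<^sub>R (X *v x + Y *v (Y *v x))"
        unfolding F_def
        by (simp add: scaleR_matrix_vector_assoc[symmetric] algebra_simps matrix_vector_mul_assoc)
      ultimately have "norm (F Y *v x) \<le> s\<^sup>2 * norm x" by simp
      also have "\<dots> \<le> s * norm x"
        using s by (intro mult_right_mono) (auto simp: power2_eq_square mult_left_le)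
      finally show ?thesis .
    qed
    with that sym show ?thesis
      by (simp add: K_def F_def transpose_scalar transpose_add matrix_transpose_mul)
  qed
  then have "F \<in> K \<rightarrow> K" by blast
  ultimately obtain Y where Y: "Y \<in> K" "F Y = Y" by (rule brouwer)
  then have "2 *\<^sub>R Y = 2 *\<^sub>R ((1/2) *\<^sub>R (X + Y ** Y))" unfolding F_def by metis
  then have "X + Y ** Y = Y + Y" by (simp add: scaleR_2)
  then have "(mat 1 - Y) ** (mat 1 - Y) = mat 1 - X"
    by (simp add: matrix_diff_ldistrib matrix_diff_rdistrib algebra_simps)
  with Y(1) show thesis by (intro that) (auto simp: K_def)
qed

text \<open>With X = E^T E the previous lemma gives a square root H = I - Y of M^T M, and Z = M
  H^(-1) is orthogonal. From Z H = M follows M - Z = - Z Y; as \<open>Z\<close> preserves norms, the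
  difference inherits the bound on \<open>Y\<close>.\<close>

lemma ex_orthogonal_near:
  fixes M :: "real^'r^'r" and E :: "real^'r^'k"
  assumes ME: "transpose M ** M + transpose E ** E = mat 1"
    and E: "\<And>x. norm (E *v x) \<le> s * norm x" and s: "0 \<le> s" "s < 1"
  obtains Z where "Z \<in> orthonormal_columns" "\<And>x. norm ((M - Z) *v x) \<le> s * norm x"
proof -
  let ?X = "transpose E ** E"
  have "norm (?X *v x) \<le> s\<^sup>2 * norm x" for x
  proof -
    have "norm (transpose E *v (E *v x)) \<le> s * (s * norm x)"
      by (rule order_trans[OF norm_transpose_mult_le[OF E] mult_left_mono[OF E s(1)]])
    then show ?thesis by (simp add: matrix_vector_mul_assoc power2_eq_square mult_ac)
  qed
  moreover have "transpose ?X = ?X" by (simp add: matrix_transpose_mul)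
  ultimately obtain Y where Y: "transpose Y = Y" "\<And>x. norm (Y *v x) \<le> s * norm x"
    "(mat 1 - Y) ** (mat 1 - Y) = mat 1 - ?X"
    using ex_sqrt_one_minus[of ?X s] s by auto
  define H where "H = mat 1 - Y"
  \<comment> \<open>A kernel vector of \<open>H\<close> is fixed by \<open>Y\<close>, whose norm is
    at most s < 1; so \<open>H\<close> is invertible.\<close>
  have "x = 0" if "H *v x = 0" for x
  proof -
    from that have "Y *v x = x" by (simp add: H_def algebra_simps)
    with Y(2)[of x] s have "norm x * (1 - s) \<le> 0" by (simp add: algebra_simps)
    with s show "x = 0" by (simp add: mult_le_0_iff)
  qed
  then obtain J where JH: "J ** H = mat 1"
    using matrix_left_invertible_ker by blast
  then have HJ: "H ** J = mat 1" by (simp add: matrix_left_right_inverse)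
  have tH: "transpose H = H" by (simp add: H_def transpose_diff Y(1))
  have tJH: "transpose J ** H = mat 1"
    using arg_cong[OF HJ, of transpose] by (simp add: matrix_transpose_mul tH)
  define Z where "Z = M ** J"
  have HH: "transpose M ** M = H ** H"
    using ME Y(3) unfolding H_def by (metis add_diff_cancel_right')
  have "transpose Z ** Z = transpose J ** (transpose M ** M) ** J"
    by (simp add: Z_def matrix_transpose_mul matrix_mul_assoc)
  also have "\<dots> = (transpose J ** H) ** (H ** J)"
    unfolding HH by (simp add: matrix_mul_assoc)
  finally have Z: "Z \<in> orthonormal_columns"
    by (simp add: tJH HJ orthonormal_columns_def)
  have "Z ** H = M" by (simp add: Z_def matrix_mul_assoc[symmetric] JH)
  then have "Z = M + Z ** Y" by (auto simp: H_def matrix_diff_ldistrib)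
  then have "Z *v x - M *v x = Z *v (Y *v x)" for x
    by (metis add_diff_cancel_left' matrix_vector_mult_add_rdistrib matrix_vector_mul_assoc)
  then have "norm ((M - Z) *v x) = norm (Z *v (Y *v x))" for x
    by (metis matrix_vector_mult_diff_rdistrib norm_minus_commute)
  then have "norm ((M - Z) *v x) \<le> s * norm x" for x
    using Y(2)[of x] by (simp add: norm_orthonormal_mult[OF Z])
  with Z show thesis by (rule that)
qed

section \<open>Orthogonal splittings\<close>

text \<open>Orthogonality of [V W] written block by block, which keeps the sum type of
  \<open>hcat\<close> out of the later computations.\<close>

definition orthogonal_split :: "real^'r^'n \<Rightarrow> real^'k^'n \<Rightarrow> bool" where
  "orthogonal_split V W \<longleftrightarrow> V \<in> orthonormal_columns \<and> W \<in> orthonormal_columns \<and>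
    transpose V ** W = 0 \<and> V ** transpose V + W ** transpose W = mat 1"

text \<open>The first product yields the relations among the columns, the second the resolution of
  the identity by the two projections.\<close>

lemma hcat_orthogonal_split:
  fixes V :: "real^'r^'n" and W :: "real^'k^'n"
  assumes 1: "transpose (hcat V W) ** hcat V W = mat 1" and 2: "hcat V W ** transpose (hcat V W) = mat 1"
  shows "orthogonal_split V W"
  unfolding orthogonal_split_def
proof (intro conjI)
  have gram: "(\<Sum>m\<in>UNIV. hcat V W $ m $ i * hcat V W $ m $ j) = (if i = j then 1 else 0)" for i j
    using arg_cong[OF 1, of "\<lambda>M. M $ i $ j"]
    by (simp add: matrix_matrix_mult_def transpose_def mat_def)
  show "V \<in> orthonormal_columns"
    unfolding orthonormal_columns_def using gram[of "Inl i" "Inl j" for i j]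
    by (simp add: vec_eq_iff matrix_matrix_mult_def transpose_def mat_def hcat_def)
  show "W \<in> orthonormal_columns"
    unfolding orthonormal_columns_def using gram[of "Inr i" "Inr j" for i j]
    by (simp add: vec_eq_iff matrix_matrix_mult_def transpose_def mat_def hcat_def)
  show "transpose V ** W = 0"
    using gram[of "Inl i" "Inr j" for i j]
    by (simp add: vec_eq_iff matrix_matrix_mult_def transpose_def mat_def hcat_def)
  have sum_UNIV: "sum f UNIV = (\<Sum>a\<in>UNIV. f (Inl a)) + (\<Sum>b\<in>UNIV. f (Inr b))"
    for f :: "'r + 'k \<Rightarrow> real"
    using sum.Plus[of "UNIV :: 'r set" "UNIV :: 'k set" f] by simp
  have "(\<Sum>m\<in>UNIV. hcat V W $ i $ m * hcat V W $ j $ m) = (if i = j then 1 else 0)" for i j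
    using arg_cong[OF 2, of "\<lambda>M. M $ i $ j"]
    by (simp add: matrix_matrix_mult_def transpose_def mat_def)
  then show "V ** transpose V + W ** transpose W = mat 1"
    by (simp add: vec_eq_iff matrix_matrix_mult_def transpose_def mat_def hcat_def sum_UNIV)
qed

lemma orthogonal_splitD:
  assumes "orthogonal_split V W"
  shows "V \<in> orthonormal_columns" and "W \<in> orthonormal_columns"
    and "transpose V ** V = mat 1" and "transpose W ** W = mat 1"
    and "transpose V ** W = 0" and "transpose W ** V = 0"
    and "V ** transpose V + W ** transpose W = mat 1"
proof -
  have VW: "transpose V ** W = 0" using assms by (simp add: orthogonal_split_def)
  have "transpose W ** V = transpose (transpose V ** W)"
    by (simp add: matrix_transpose_mul)
  then show "transpose W ** V = 0"
    unfolding VW by (simp add: transpose_def vec_eq_iff)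
qed (use assms in \<open>auto simp: orthogonal_split_def orthonormal_columns_def\<close>)

section \<open>Angles between a subspace and an orthogonal splitting\<close>

lemma pythagoras:
  assumes split: "orthogonal_split V W"
  shows "(norm (transpose V *v y))\<^sup>2 + (norm (transpose W *v y))\<^sup>2 = (norm y)\<^sup>2"
proof -
  have "y = V *v (transpose V *v y) + W *v (transpose W *v y)"
    by (metis orthogonal_splitD(7)[OF split] matrix_vector_mul_assoc matrix_vector_mul_lid matrix_vector_mult_add_rdistrib)
  then have "inner y y = inner y (V *v (transpose V *v y)) + inner y (W *v (transpose W *v y))"
    by (metis inner_add_right)
  then show ?thesis
    by (simp add: power2_norm_eq_inner flip: inner_transpose_mult)
qed

lemma pythagoras_orthonormal:
  assumes split: "orthogonal_split V W" and U: "U \<in> orthonormal_columns"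
  shows "(norm ((transpose V ** U) *v x))\<^sup>2 + (norm ((transpose W ** U) *v x))\<^sup>2 = (norm x)\<^sup>2"
  using pythagoras[OF split, of "U *v x"] U by (simp add: matrix_vector_mul_assoc norm_orthonormal_mult)

text \<open>The spectral norm is taken of U^T W, while the transpose acts on coordinates; both obey
  the same bound. For orthonormal \<open>U\<close> and a splitting by \<open>V\<close> and
  \<open>W\<close> it is the sine of the largest principal angle between \<open>U\<close> and
  \<open>V\<close>.\<close>

lemma norm_sin_le: "norm ((transpose W ** U) *v x) \<le> spectral_norm (transpose U ** W) * norm x"
  using norm_transpose_mult_le[OF norm_mult_le_spectral_norm, of "transpose U ** W" x]
  by (simp add: matrix_transpose_mul)

text \<open>sqrt (1 - d^2) is the cosine that belongs to the sine \<open>d\<close>; the Pythagorean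
  identity converts one bound into the other at each \<open>x\<close>.\<close>

lemma norm_cos_ge:
  assumes split: "orthogonal_split V W" and U: "U \<in> orthonormal_columns" and d: "d \<le> 1"
    and sin: "\<And>x. norm ((transpose W ** U) *v x) \<le> d * norm x"
  shows "sqrt (1 - d\<^sup>2) * norm x \<le> norm ((transpose V ** U) *v x)"
proof -
  have "(norm ((transpose W ** U) *v x))\<^sup>2 \<le> (d * norm x)\<^sup>2"
    by (intro power_mono sin) simp
  then have "(1 - d\<^sup>2) * (norm x)\<^sup>2 \<le> (norm ((transpose V ** U) *v x))\<^sup>2"
    using pythagoras_orthonormal[OF split U, of x] by (simp add: algebra_simps power_mult_distrib)
  then have "sqrt ((1 - d\<^sup>2) * (norm x)\<^sup>2) \<le> norm ((transpose V ** U) *v x)"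
    by (rule real_le_lsqrt[OF norm_ge_zero])
  then show ?thesis by (simp add: real_sqrt_mult)
qed

(* P = U U^T and I - W W^T = V V^T =: P' satisfy P - P' = P (I - P') - (I - P) P' with orthogonal
   ranges; both summands have norm at most d since the square matrix V^T U and its transpose
   have the same smallest singular value. *)
lemma dist2_eq_spectral_norm:
  fixes U V :: "real^'r^'n" and W :: "real^'k^'n"
  assumes split: "orthogonal_split V W"
    and U: "U \<in> orthonormal_columns" and d1: "spectral_norm (transpose U ** W) < 1"
  shows "dist2 U V = spectral_norm (transpose U ** W)"
proof -
  define d where "d = spectral_norm (transpose U ** W)"
  have d: "0 \<le> d" "d < 1" using d1 spectral_norm_nonneg by (auto simp: d_def)
  then have d_sq: "0 < 1 - d\<^sup>2" by (simp add: power_less_one_iff abs_square_less_1)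
  have UU: "transpose U ** U = mat 1" using U by (simp add: orthonormal_columns_def)
  have sin: "norm ((transpose W ** U) *v x) \<le> d * norm x" for x
    unfolding d_def by (rule norm_sin_le)
  define S where "S = transpose V ** U"
  have S: "sqrt (1 - d\<^sup>2) * norm x \<le> norm (S *v x)" for x
    unfolding S_def using d by (intro norm_cos_ge[OF split] U sin) auto
  have "x = 0" if "S *v x = 0" for x
    using S[of x] that d_sq by (simp add: mult_le_0_iff)
  \<comment> \<open>\<open>S\<close> is square, so \<open>J\<close> is a two-sided inverse. The
    lower bound on \<open>S\<close> is an upper bound on \<open>J\<close>, passes to J^T, and
    returns as the same lower bound on S^T.\<close>
  then obtain J where "J ** S = mat 1" using matrix_left_invertible_ker by blast
  then have SJ: "S ** J = mat 1" by (simp add: matrix_left_right_inverse)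
  have "norm (J *v x) \<le> (1 / sqrt (1 - d\<^sup>2)) * norm x" for x
    using S[of "J *v x"] d_sq by (simp add: matrix_vector_mul_assoc SJ field_simps)
  then have J: "norm (transpose J *v x) \<le> (1 / sqrt (1 - d\<^sup>2)) * norm x" for x
    by (rule norm_transpose_mult_le)
  have tS: "sqrt (1 - d\<^sup>2) * norm y \<le> norm (transpose S *v y)" for y
  proof -
    have "transpose J *v (transpose S *v y) = y"
      by (simp add: matrix_vector_mul_assoc flip: matrix_transpose_mul) (simp add: SJ)
    with J[of "transpose S *v y"] d_sq show ?thesis by (simp add: field_simps)
  qed
  let ?D = "U ** transpose U - V ** transpose V"
  have "norm (?D *v x) \<le> d * norm x" for x
  proof -
    \<comment> \<open>With P = U U^T and P' = V V^T these are p = P (I - P') x, v = P' x and q = (I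
      - P) P' x.\<close>
    define p where "p = U *v (transpose U *v (W *v (transpose W *v x)))"
    define v where "v = V *v (transpose V *v x)"
    define q where "q = v - U *v (transpose U *v v)"
    have x: "x = v + W *v (transpose W *v x)"
      unfolding v_def
      by (metis orthogonal_splitD(7)[OF split] matrix_vector_mul_assoc matrix_vector_mul_lid matrix_vector_mult_add_rdistrib)
    have Uq: "transpose U *v q = 0"
      by (simp add: q_def matrix_vector_mult_diff_distrib matrix_vector_mul_assoc UU matrix_mul_assoc)
    have "?D *v x = U *v (transpose U *v x) - v"
      by (simp add: v_def matrix_vector_mult_diff_rdistrib matrix_vector_mul_assoc)
    also have "U *v (transpose U *v x) = U *v (transpose U *v v) + p"
      unfolding p_def by (subst x) (simp only: matrix_vector_right_distrib)
    finally have D: "?D *v x = p - q" by (simp add: q_def)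
    have "inner p q = 0"
      unfolding p_def by (subst inner_commute, subst inner_transpose_mult[symmetric]) (simp add: Uq)
    then have D2: "(norm (?D *v x))\<^sup>2 = (norm p)\<^sup>2 + (norm q)\<^sup>2"
      unfolding D by (simp add: power2_norm_eq_inner inner_diff inner_commute)
    have "norm p = norm ((transpose U ** W) *v (transpose W *v x))"
      unfolding p_def norm_orthonormal_mult[OF U]
      by (simp add: matrix_vector_mul_assoc matrix_mul_assoc)
    also have "\<dots> \<le> d * norm (transpose W *v x)"
      unfolding d_def by (rule norm_mult_le_spectral_norm)
    finally have p: "(norm p)\<^sup>2 \<le> (d * norm (transpose W *v x))\<^sup>2" by (intro power_mono) auto
    have nv: "norm v = norm (transpose V *v x)"
      unfolding v_def by (rule norm_orthonormal_mult[OF orthogonal_splitD(1)[OF split]])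
    have "transpose U *v v = transpose S *v (transpose V *v x)"
      by (simp add: v_def S_def matrix_transpose_mul matrix_vector_mul_assoc matrix_mul_assoc)
    then have "sqrt (1 - d\<^sup>2) * norm v \<le> norm (transpose U *v v)"
      using tS nv by metis
    then have "(sqrt (1 - d\<^sup>2) * norm v)\<^sup>2 \<le> (norm (transpose U *v v))\<^sup>2"
      using d_sq by (intro power_mono) auto
    then have "(1 - d\<^sup>2) * (norm v)\<^sup>2 \<le> (norm (transpose U *v v))\<^sup>2"
      using d_sq by (simp add: power_mult_distrib)
    \<comment> \<open>Pythagoras for P turns the cosine bound on U^T v into the sine bound |q| <= d
      |v|.\<close>
    moreover have "(norm v)\<^sup>2 = (norm q)\<^sup>2 + (norm (transpose U *v v))\<^sup>2"
    proof -
      have "inner (U *v (transpose U *v v)) q = 0"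
        by (subst inner_commute, subst inner_transpose_mult[symmetric]) (simp add: Uq)
      then have "(norm (q + U *v (transpose U *v v)))\<^sup>2 = (norm q)\<^sup>2 + (norm (U *v (transpose U *v v)))\<^sup>2"
        by (simp add: power2_norm_eq_inner inner_add inner_commute)
      then show ?thesis by (simp add: q_def norm_orthonormal_mult[OF U])
    qed
    ultimately have q: "(norm q)\<^sup>2 \<le> (d * norm (transpose V *v x))\<^sup>2"
      by (simp add: nv algebra_simps power_mult_distrib)
    have "(norm (?D *v x))\<^sup>2 \<le> d\<^sup>2 * ((norm (transpose V *v x))\<^sup>2 + (norm (transpose W *v x))\<^sup>2)"
      unfolding D2 using p q by (simp add: algebra_simps power_mult_distrib)
    also have "\<dots> = (d * norm x)\<^sup>2" by (simp add: pythagoras[OF split] power_mult_distrib)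
    finally show ?thesis by (rule power2_le_imp_le) (simp add: d)
  qed
  then have "dist2 U V \<le> d" unfolding dist2_def using d by (intro spectral_norm_le) auto
  \<comment> \<open>Conversely, V V^T vanishes on the range of \<open>W\<close>, so the difference
    of projections acts there as U (U^T W), and both \<open>U\<close> and \<open>W\<close> are
    isometries.\<close>
  moreover have "d \<le> dist2 U V"
    unfolding d_def
  proof (rule spectral_norm_le)
    show "0 \<le> dist2 U V" by (simp add: dist2_def spectral_norm_nonneg)
    fix y
    have "?D ** W = U ** (transpose U ** W)"
      by (simp add: matrix_diff_rdistrib orthogonal_splitD(5)[OF split] flip: matrix_mul_assoc)
    then have "?D *v (W *v y) = U *v ((transpose U ** W) *v y)"
      by (simp only: matrix_vector_mul_assoc)
    then have "norm ((transpose U ** W) *v y) = norm (?D *v (W *v y))"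
      by (simp add: norm_orthonormal_mult[OF U])
    also have "\<dots> \<le> dist2 U V * norm (W *v y)"
      unfolding dist2_def by (rule norm_mult_le_spectral_norm)
    finally show "norm ((transpose U ** W) *v y) \<le> dist2 U V * norm y"
      by (simp add: norm_orthonormal_mult[OF orthogonal_splitD(2)[OF split]])
  qed
  ultimately show ?thesis by (simp add: d_def)
qed

text \<open>This is the whole estimate for one matrix \<open>U\<close> whose coordinates, up to the
  right factor \<open>R\<close>, are those of \<open>U0\<close> multiplied by \<open>D\<close> and
  \<open>D'\<close>; powers enter only when it is applied. \<open>Z0\<close> stays free so that the
  infimum can be taken afterwards.\<close>

lemma dist_2inf_split_le:
  fixes U U0 V :: "real^'r^'n" and W :: "real^'k^'n"
  assumes split: "orthogonal_split V W"
    and U: "U \<in> orthonormal_columns" and U0: "U0 \<in> orthonormal_columns"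
    and VR: "transpose V ** U ** R = D ** (transpose V ** U0)"
    and WR: "transpose W ** U ** R = D' ** (transpose W ** U0)"
    and D: "\<And>x. l * norm x \<le> norm (D *v x)" "0 < l"
    and D': "\<And>x. norm (D' *v x) \<le> a * norm x" "0 \<le> a"
    and sin: "\<And>x. norm ((transpose W ** U0) *v x) \<le> d * norm x" and d: "0 \<le> d" "d < 1"
  shows "dist_2inf U V \<le> norm_2inf V * (a / l * (d / sqrt (1 - d\<^sup>2)))
    + norm_inf (W ** D' ** transpose W) / (l * sqrt (1 - d\<^sup>2)) * norm_2inf (U0 - V ** Z0)"
proof -
  define c where "c = sqrt (1 - d\<^sup>2)"
  \<comment> \<open>d / c is the tangent of the initial angle; passing from \<open>U0\<close> to
    \<open>U\<close> multiplies its bound by a / l.\<close>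
  define \<tau> where "\<tau> = a / l * (d / c)"
  have c: "0 < c" using d by (simp add: c_def power_less_one_iff abs_square_less_1)
  have \<tau>: "0 \<le> \<tau>" using D D' d c by (simp add: \<tau>_def)
  have DS: "l * c * norm w \<le> norm (D *v ((transpose V ** U0) *v w))" for w
  proof -
    have "l * (c * norm w) \<le> l * norm ((transpose V ** U0) *v w)"
      unfolding c_def using D(2) d by (intro mult_left_mono norm_cos_ge[OF split] U0 sin) auto
    also have "\<dots> \<le> norm (D *v ((transpose V ** U0) *v w))" by (rule D)
    finally show ?thesis by (simp add: mult.assoc)
  qed
  define M where "M = transpose V ** U"
  define E where "E = transpose W ** U"
  have MR: "M *v (R *v w) = D *v ((transpose V ** U0) *v w)"
    and ER: "E *v (R *v w) = D' *v ((transpose W ** U0) *v w)" for w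
    using VR WR by (simp_all add: M_def E_def matrix_vector_mul_assoc)
  \<comment> \<open>D V^T U0 is bounded below by l c > 0, hence \<open>R\<close> is injective and,
    being square, invertible.\<close>
  have "w = 0" if "R *v w = 0" for w
    using DS[of w] MR[of w] that D(2) c by (auto simp: mult_le_0_iff)
  then obtain J where "J ** R = mat 1" using matrix_left_invertible_ker by blast
  then have RJ: "R ** J = mat 1" by (simp add: matrix_left_right_inverse)
  have J: "l * c * norm (J *v x) \<le> norm (M *v x)" for x
    using DS[of "J *v x"] MR[of "J *v x"] by (simp add: matrix_vector_mul_assoc RJ)
  have tan: "norm (E *v x) \<le> \<tau> * norm (M *v x)" for x
  proof -
    have "norm (E *v x) = norm (D' *v ((transpose W ** U0) *v (J *v x)))"
      using ER[of "J *v x"] by (simp add: matrix_vector_mul_assoc RJ)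
    also have "\<dots> \<le> a * (d * norm (J *v x))"
      by (rule order_trans[OF D'(1) mult_left_mono[OF sin D'(2)]])
    also have "\<dots> = \<tau> * (l * c * norm (J *v x))"
      using D(2) c by (simp add: \<tau>_def field_simps)
    also have "\<dots> \<le> \<tau> * norm (M *v x)" by (intro mult_left_mono J \<tau>)
    finally show ?thesis .
  qed
  have pyth: "(norm (M *v x))\<^sup>2 + (norm (E *v x))\<^sup>2 = (norm x)\<^sup>2" for x
    unfolding M_def E_def by (rule pythagoras_orthonormal[OF split U])
  have M1: "norm (M *v x) \<le> norm x" for x
    by (rule power2_le_imp_le) (simp_all flip: pyth[of x])
  \<comment> \<open>The sine of the angle with tangent \<tau>. \<open>ex_orthogonal_near\<close>
    requires a bound below 1, which \<tau> itself need not satisfy; afterwards s is replaced by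
    \<tau> again.\<close>
  define s where "s = \<tau> / sqrt (1 + \<tau>\<^sup>2)"
  have sq: "\<tau> < sqrt (1 + \<tau>\<^sup>2)" "1 \<le> sqrt (1 + \<tau>\<^sup>2)" by (auto intro: real_less_rsqrt)
  then have sq_pos: "0 < sqrt (1 + \<tau>\<^sup>2)" by linarith
  have s: "0 \<le> s" "s < 1" "s \<le> \<tau>"
  proof -
    show "0 \<le> s" unfolding s_def using \<tau> sq_pos by (intro divide_nonneg_pos)
    show "s < 1" unfolding s_def by (subst divide_less_eq_1_pos[OF sq_pos]) (rule sq)
    show "s \<le> \<tau>"
      unfolding s_def pos_divide_le_eq[OF sq_pos] using mult_left_mono[OF sq(2) \<tau>] by simp
  qed
  have Es: "norm (E *v x) \<le> s * norm x" for x
  proof -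
    \<comment> \<open>Replace |M x|^2 by |x|^2 - |E x|^2 and solve for |E x|^2.\<close>
    have "(norm (E *v x))\<^sup>2 \<le> (\<tau> * norm (M *v x))\<^sup>2" by (intro power_mono tan) simp
    also have "\<dots> = \<tau>\<^sup>2 * ((norm x)\<^sup>2 - (norm (E *v x))\<^sup>2)"
      by (simp add: power_mult_distrib flip: pyth[of x])
    finally have "(norm (E *v x))\<^sup>2 * (1 + \<tau>\<^sup>2) \<le> \<tau>\<^sup>2 * (norm x)\<^sup>2" by (simp add: algebra_simps)
    moreover have "0 < 1 + \<tau>\<^sup>2" by (simp add: add_pos_nonneg)
    ultimately have "(norm (E *v x))\<^sup>2 \<le> (s * norm x)\<^sup>2"
      by (simp add: s_def power_mult_distrib power_divide field_simps)
    then show ?thesis by (rule power2_le_imp_le) (simp add: s)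
  qed
  have "transpose M ** M + transpose E ** E
    = transpose U ** ((V ** transpose V + W ** transpose W) ** U)"
    by (simp add: M_def E_def matrix_eq matrix_transpose_mul algebra_simps flip: matrix_vector_mul_assoc)
  then have "transpose M ** M + transpose E ** E = mat 1"
    using U by (simp add: orthogonal_splitD(7)[OF split] orthonormal_columns_def)
  then obtain Z where Z: "Z \<in> orthonormal_columns" "\<And>x. norm ((M - Z) *v x) \<le> s * norm x"
    using ex_orthogonal_near[OF _ Es s(1,2)] by blast
  have Zt: "norm ((M - Z) *v x) \<le> \<tau> * norm x" for x
    using Z(2)[of x] mult_right_mono[OF s(3) norm_ge_zero[of x]] by linarith
  have "U = (V ** transpose V + W ** transpose W) ** U"
    by (simp add: orthogonal_splitD(7)[OF split])
  also have "\<dots> = V ** M + W ** E"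
    by (simp add: M_def E_def matrix_eq algebra_simps flip: matrix_vector_mul_assoc)
  finally have "U - V ** Z = V ** (M - Z) + W ** E"
    by (simp add: matrix_diff_ldistrib)
  moreover have "W ** E = (W ** D' ** transpose W) ** (U0 - V ** Z0) ** J"
  proof -
    have "E = E ** (R ** J)" by (simp add: RJ)
    also have "\<dots> = (E ** R) ** J" by (simp add: matrix_mul_assoc)
    also have "\<dots> = D' ** (transpose W ** U0) ** J" by (simp add: E_def WR)
    \<comment> \<open>As W^T V = 0, subtracting \<open>V ** Z0\<close> changes nothing, but it
      leaves the matrix whose rows \<open>dist_2inf\<close> measures.\<close>
    also have "transpose W ** U0 = transpose W ** (U0 - V ** Z0)"
      by (simp add: matrix_diff_ldistrib matrix_mul_assoc orthogonal_splitD(6)[OF split])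
    finally show ?thesis by (simp add: matrix_mul_assoc)
  qed
  ultimately have "norm_2inf (U - V ** Z) \<le> norm_2inf (V ** (M - Z))
      + norm_2inf ((W ** D' ** transpose W) ** (U0 - V ** Z0) ** J)"
    by (metis norm_2inf_add)
  also have "\<dots> \<le> norm_2inf V * \<tau>
      + norm_inf (W ** D' ** transpose W) * norm_2inf (U0 - V ** Z0) * (1 / (l * c))"
  proof (rule add_mono)
    show "norm_2inf (V ** (M - Z)) \<le> norm_2inf V * \<tau>"
      by (rule norm_2inf_mult_le[OF Zt \<tau>])
    have "norm (J *v x) \<le> 1 / (l * c) * norm x" for x
      using order_trans[OF J M1, of x] D(2) c by (simp add: field_simps)
    then have "norm_2inf ((W ** D' ** transpose W) ** (U0 - V ** Z0) ** J)
        \<le> norm_2inf ((W ** D' ** transpose W) ** (U0 - V ** Z0)) * (1 / (l * c))"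
      using D(2) c by (intro norm_2inf_mult_le) auto
    also have "\<dots> \<le> norm_inf (W ** D' ** transpose W) * norm_2inf (U0 - V ** Z0) * (1 / (l * c))"
      using D(2) c by (intro mult_right_mono norm_2inf_mult_le_norm_inf) auto
    finally show "norm_2inf ((W ** D' ** transpose W) ** (U0 - V ** Z0) ** J)
        \<le> norm_inf (W ** D' ** transpose W) * norm_2inf (U0 - V ** Z0) * (1 / (l * c))" .
  qed
  finally show ?thesis
    using dist_2inf_le[OF Z(1), of U V] by (simp add: \<tau>_def c_def)
qed

section \<open>Powers and the iteration\<close>

lemma diag_matrix_mult_nth: "(diag_matrix d *v x) $ i = d i * x $ i"
  by (simp add: diag_matrix_def matrix_vector_mult_def if_distrib if_distribR cong: if_cong)

lemma matrix_power_diag: "matrix_power (diag_matrix d) t = diag_matrix (\<lambda>i. d i ^ t)"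
proof (induction t)
  case 0
  show ?case by (simp add: diag_matrix_def mat_def)
next
  case (Suc t)
  then show ?case
    by (simp add: matrix_eq vec_eq_iff diag_matrix_mult_nth mult.assoc flip: matrix_vector_mul_assoc)
qed

lemma norm_diag_matrix_le: "norm (diag_matrix d *v x) \<le> b * norm x" if "\<And>i. \<bar>d i\<bar> \<le> b"
proof -
  have "0 \<le> b" using that abs_ge_zero order_trans by blast
  then have "norm (diag_matrix d *v x) \<le> norm (b *\<^sub>R x)"
    using that by (intro norm_le_componentwise_cart) (simp add: diag_matrix_mult_nth abs_mult mult_right_mono)
  with \<open>0 \<le> b\<close> show ?thesis by simp
qed

lemma norm_diag_matrix_ge: "b * norm x \<le> norm (diag_matrix d *v x)" if "\<And>i. b \<le> \<bar>d i\<bar>" "0 \<le> b"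
proof -
  have "norm (b *\<^sub>R x) \<le> norm (diag_matrix d *v x)"
    using that by (intro norm_le_componentwise_cart) (simp add: diag_matrix_mult_nth abs_mult mult_right_mono)
  with that(2) show ?thesis by simp
qed

text \<open>V^T A = D V^T and W^T A = D' W^T, so the two coordinate blocks evolve separately.
  \<open>R\<close> is the product of the QR factors so far, newest on the left, and is common to
  both blocks.\<close>

lemma subspace_iteration_components:
  fixes V Q0 :: "real^('r::{finite,linorder})^'n" and W :: "real^'k^'n"
  assumes split: "orthogonal_split V W"
    and A: "A = V ** D ** transpose V + W ** D' ** transpose W"
    and iter: "subspace_iteration A Q0 Q"
  shows "\<exists>R. transpose V ** Q t ** R = matrix_power D t ** (transpose V ** Q0) \<and>
    transpose W ** Q t ** R = matrix_power D' t ** (transpose W ** Q0)"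
proof (induction t)
  case 0
  show ?case using iter by (intro exI[of _ "mat 1"]) (simp add: subspace_iteration_def)
next
  case (Suc t)
  obtain R where R: "transpose V ** Q t ** R = matrix_power D t ** (transpose V ** Q0)"
    "transpose W ** Q t ** R = matrix_power D' t ** (transpose W ** Q0)"
    using Suc by blast
  from iter have "\<exists>R. qr_decomposition (A ** Q (Suc t - 1)) (Q (Suc t)) R"
    unfolding subspace_iteration_def by (metis le_add1 plus_1_eq_Suc)
  then obtain R' where R': "A ** Q t = Q (Suc t) ** R'"
    by (auto simp: qr_decomposition_def)
  have VA: "transpose V ** A = D ** transpose V" and WA: "transpose W ** A = D' ** transpose W"
    by (simp_all add: A matrix_add_ldistrib matrix_mul_assoc orthogonal_splitD[OF split])
  have *: "X ** Q (Suc t) ** (R' ** R) = (X ** A) ** Q t ** R" for X :: "real^'n^'m"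
    using R' by (metis matrix_mul_assoc)
  show ?case
  proof (intro exI conjI)
    show "transpose V ** Q (Suc t) ** (R' ** R) = matrix_power D (Suc t) ** (transpose V ** Q0)"
      unfolding * VA using R(1) by (simp flip: matrix_mul_assoc)
    show "transpose W ** Q (Suc t) ** (R' ** R) = matrix_power D' (Suc t) ** (transpose W ** Q0)"
      unfolding * WA using R(2) by (simp flip: matrix_mul_assoc)
  qed
qed

text \<open>Passes a bound valid for every orthogonal \<open>Z\<close> to the infimum, without a
  minimizer. The case \<beta> = 0 is separate because the argument divides by \<beta>.\<close>

lemma dist_2inf_affine:
  fixes U W :: "real^'r^'n"
  assumes le: "\<And>Z :: real^'r^'r. Z \<in> orthonormal_columns \<Longrightarrow> y \<le> \<alpha> + \<beta> * norm_2inf (U - W ** Z)"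
    and "0 \<le> \<beta>"
  shows "y \<le> \<alpha> + \<beta> * dist_2inf U W"
proof (cases "\<beta> = 0")
  case True
  then show ?thesis using le[OF mat_1_orthonormal] by simp
next
  case False
  with \<open>0 \<le> \<beta>\<close> have "0 < \<beta>" by simp
  then have "(y - \<alpha>) / \<beta> \<le> dist_2inf U W"
    using le by (intro dist_2inf_greatest) (simp add: field_simps)
  with \<open>0 < \<beta>\<close> show ?thesis by (simp add: field_simps)
qed

section \<open>Row sums: the complementary projection and the hypothesis on powers\<close>

lemma sum_abs_le_norm: "(\<Sum>j\<in>UNIV. \<bar>x $ j\<bar>) \<le> sqrt (real CARD('n)) * norm x" for x :: "real^'n"
  using L2_set_mult_ineq[of "\<lambda>j. x $ j" "\<lambda>_. 1" UNIV]
  by (simp add: norm_vec_def L2_set_def mult.commute)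

text \<open>W W^T = I - V V^T. A row of I has absolute sum 1; a row of V V^T is as long as the same
  row of \<open>V\<close>, and Cauchy-Schwarz costs sqrt n.\<close>

lemma norm_inf_complement_le:
  fixes V :: "real^'r^'n" and W :: "real^'k^'n"
  assumes split: "orthogonal_split V W"
  shows "norm_inf (W ** transpose W) \<le> 1 + sqrt (real CARD('n)) * norm_2inf V"
proof (rule norm_inf_le)
  fix i
  let ?P = "V ** transpose V"
  have P: "W ** transpose W = mat 1 - ?P" using orthogonal_splitD(7)[OF split] by (metis add_diff_cancel_left')
  have "(\<Sum>j\<in>UNIV. \<bar>?P $ i $ j\<bar>) \<le> sqrt (real CARD('n)) * norm (row i ?P)"
    using sum_abs_le_norm[of "row i ?P"] by (simp add: row_def)
  also have "norm (row i ?P) = norm (row i V)"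
    unfolding row_matrix_mult by (simp add: norm_orthonormal_mult[OF orthogonal_splitD(1)[OF split]])
  also have "sqrt (real CARD('n)) * \<dots> \<le> sqrt (real CARD('n)) * norm_2inf V"
    by (intro mult_left_mono norm_row_le) simp
  finally have "(\<Sum>j\<in>UNIV. \<bar>(mat 1 :: real^'n^'n) $ i $ j\<bar>) + (\<Sum>j\<in>UNIV. \<bar>?P $ i $ j\<bar>)
      \<le> 1 + sqrt (real CARD('n)) * norm_2inf V"
    by (simp add: mat_def if_distrib cong: if_cong)
  moreover have "(\<Sum>j\<in>UNIV. \<bar>(W ** transpose W) $ i $ j\<bar>)
      \<le> (\<Sum>j\<in>UNIV. \<bar>(mat 1 :: real^'n^'n) $ i $ j\<bar>) + (\<Sum>j\<in>UNIV. \<bar>?P $ i $ j\<bar>)"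
    unfolding P by (simp add: abs_triangle_ineq4 sum_mono flip: sum.distrib)
  ultimately show "(\<Sum>j\<in>UNIV. \<bar>(W ** transpose W) $ i $ j\<bar>)
      \<le> 1 + sqrt (real CARD('n)) * norm_2inf V" by linarith
qed

text \<open>The columns of \<open>W\<close> are unit eigenvectors with eigenvalues
  \<open>d k\<close>.\<close>

lemma abs_le_norm_inf_diag:
  assumes split: "orthogonal_split V W"
  shows "\<bar>d k\<bar> \<le> norm_inf (W ** diag_matrix d ** transpose W)"
proof (rule abs_eigenvalue_le_norm_inf)
  have "diag_matrix d *v axis k 1 = d k *\<^sub>R axis k 1"
    by (simp add: vec_eq_iff diag_matrix_mult_nth axis_def)
  then have "W *v (diag_matrix d *v axis k 1) = d k *\<^sub>R (W *v axis k 1)"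
    by (simp add: matrix_vector_mult_scaleR)
  moreover have "transpose W *v (W *v x) = x" for x
    by (simp add: matrix_vector_mul_assoc orthogonal_splitD(4)[OF split])
  ultimately show "(W ** diag_matrix d ** transpose W) *v (W *v axis k 1) = d k *\<^sub>R (W *v axis k 1)"
    by (metis matrix_vector_mul_assoc)
  have "norm (W *v axis k (1 :: real)) = 1"
    by (simp add: norm_orthonormal_mult[OF orthogonal_splitD(2)[OF split]])
  then show "W *v axis k (1 :: real) \<noteq> 0" by auto
qed

lemma abs_le_of_powers_le:
  fixes x a K :: real
  assumes "0 < a" and le: "\<And>t::nat. t \<ge> 1 \<Longrightarrow> \<bar>x\<bar> ^ t \<le> K * a ^ t"
  shows "\<bar>x\<bar> \<le> a"
proof (rule ccontr)
  assume "\<not> \<bar>x\<bar> \<le> a"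
  with \<open>0 < a\<close> have "1 < \<bar>x\<bar> / a" by simp
  then obtain m where m: "K < (\<bar>x\<bar> / a) ^ m" using real_arch_pow by blast
  \<comment> \<open>The hypothesis excludes the exponent 0, hence the passage from \<open>m\<close>
    to \<open>Suc m\<close>.\<close>
  also have "\<dots> \<le> (\<bar>x\<bar> / a) ^ Suc m"
    using \<open>1 < \<bar>x\<bar> / a\<close> by (intro power_increasing) auto
  finally show False using le[of "Suc m"] \<open>0 < a\<close> by (simp add: power_divide field_simps del: power_Suc)
qed

text \<open>Each |d k|^t is at most the row sum norm of the t-th power, so comparing growth in t
  bounds |d k| by \<open>a\<close>. Nonnegativity is stated for \<open>C * a ^ t\<close> and not for
  \<open>C\<close>, whose sign stays open when a = 0.\<close>

lemma row_sum_powers_dominate_eigenvalues: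
  fixes W :: "real^'k^'n"
  assumes split: "orthogonal_split V W"
    and C: "\<And>t::nat. 1 \<le> t \<Longrightarrow> norm_inf (W ** matrix_power (diag_matrix d) t ** transpose W)
      \<le> C * a ^ t * norm_inf (W ** transpose W)"
    and a: "d j = a"
  shows "0 \<le> a" and "\<bar>d k\<bar> \<le> a" and "1 \<le> t \<Longrightarrow> 0 \<le> C * a ^ t"
proof -
  define G where "G t = W ** matrix_power (diag_matrix d) t ** transpose W" for t
  define N where "N = norm_inf (W ** transpose W)"
  have G: "norm_inf (G t) \<le> C * a ^ t * N" if "1 \<le> t" for t
    unfolding G_def N_def using that by (rule C)
  have eig: "\<bar>d k\<bar> ^ t \<le> norm_inf (G t)" for k t
    using abs_le_norm_inf_diag[OF split, of "\<lambda>i. d i ^ t"]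
    by (simp add: G_def matrix_power_diag power_abs)
  \<comment> \<open>Exponent 0: \<open>G 0\<close> is W W^T and |d k|^0 = 1;
    \<open>undefined\<close> stands for an arbitrary index.\<close>
  have N: "1 \<le> N" using eig[of undefined 0] by (simp add: G_def N_def)
  show C_nonneg: "0 \<le> C * a ^ t" if "1 \<le> t" for t
    using order_trans[OF norm_inf_nonneg G[OF that]] N by (simp add: zero_le_mult_iff)
  show a_nonneg: "0 \<le> a"
  proof (rule ccontr)
    \<comment> \<open>For a < 0 the exponent 1 forces C <= 0, and then the exponent 2 gives 0 < a^2
      <= C a^2 N <= 0.\<close>
    assume neg: "\<not> 0 \<le> a"
    then have "C \<le> 0" using C_nonneg[of 1] by (simp add: zero_le_mult_iff)
    then have "C * a\<^sup>2 * N \<le> 0" using N by (simp add: mult_nonpos_nonneg)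
    moreover have "a\<^sup>2 \<le> norm_inf (G 2)" using eig[of j 2] by (simp add: a)
    ultimately have "a\<^sup>2 \<le> 0" using G[of 2] by linarith
    with neg show False by simp
  qed
  show "\<bar>d k\<bar> \<le> a"
  \<comment> \<open>For a = 0 there is no ratio |d k| / a to compare; the exponent 1 alone gives d k
    = 0.\<close>
  proof (cases "a = 0")
    case True
    then show ?thesis using eig[of k 1] G[of 1] by simp
  next
    case False
    have "\<bar>d k\<bar> ^ t \<le> (C * N) * a ^ t" if "1 \<le> t" for t
      using order_trans[OF eig G[OF that]] by (simp add: mult_ac)
    with False a_nonneg show ?thesis by (intro abs_le_of_powers_le[of a]) auto
  qed
qed

section \<open>Assembling the bound for the iterates\<close>

lemma subspace_iteration_dist_2inf_le:
  fixes V Q0 :: "real^('r::{finite,linorder})^'n" and W :: "real^'k^'n"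
  assumes split: "orthogonal_split V W"
    and A: "A = V ** diag_matrix lam ** transpose V + W ** diag_matrix lam' ** transpose W"
    and lam: "\<And>i. l \<le> lam i" "0 < l" and lam': "\<And>k. \<bar>lam' k\<bar> \<le> a" "0 \<le> a"
    and Q0: "Q0 \<in> orthonormal_columns"
    and d: "d = spectral_norm (transpose Q0 ** W)" "d < 1"
    and iter: "subspace_iteration A Q0 Q" and t: "1 \<le> t"
  shows "dist_2inf (Q t) V \<le> norm_2inf V * (a ^ t / l ^ t * (d / sqrt (1 - d\<^sup>2)))
    + norm_inf (W ** matrix_power (diag_matrix lam') t ** transpose W) / (l ^ t * sqrt (1 - d\<^sup>2))
      * dist_2inf Q0 V"
proof (rule dist_2inf_affine)
  have d_nonneg: "0 \<le> d" by (simp add: d spectral_norm_nonneg)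
  then have "0 < 1 - d\<^sup>2" using d(2) by (simp add: abs_square_less_1)
  then show "0 \<le> norm_inf (W ** matrix_power (diag_matrix lam') t ** transpose W)
      / (l ^ t * sqrt (1 - d\<^sup>2))"
    using lam(2) by (simp add: norm_inf_nonneg)
  obtain R where R: "transpose V ** Q t ** R = matrix_power (diag_matrix lam) t ** (transpose V ** Q0)"
    "transpose W ** Q t ** R = matrix_power (diag_matrix lam') t ** (transpose W ** Q0)"
    using subspace_iteration_components[OF split A iter] by blast
  have Qt: "Q t \<in> orthonormal_columns"
    using iter t by (auto simp: subspace_iteration_def qr_decomposition_def)
  show "dist_2inf (Q t) V \<le> norm_2inf V * (a ^ t / l ^ t * (d / sqrt (1 - d\<^sup>2)))
    + norm_inf (W ** matrix_power (diag_matrix lam') t ** transpose W) / (l ^ t * sqrt (1 - d\<^sup>2))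
      * norm_2inf (Q0 - V ** Z)" for Z
  proof (rule dist_2inf_split_le[OF split Qt Q0 R])
    show "l ^ t * norm x \<le> norm (matrix_power (diag_matrix lam) t *v x)" for x
      unfolding matrix_power_diag using lam
      by (intro norm_diag_matrix_ge) (auto simp: power_abs intro!: power_mono order_trans[OF _ abs_ge_self])
    show "norm (matrix_power (diag_matrix lam') t *v x) \<le> a ^ t * norm x" for x
      unfolding matrix_power_diag
      by (intro norm_diag_matrix_le) (auto simp: power_abs intro!: power_mono lam')
    show "norm ((transpose W ** Q0) *v x) \<le> d * norm x" for x
      unfolding d(1) by (rule norm_sin_le)
  qed (use lam lam' d_nonneg d in auto)
qed

text \<open>sqrt n times sqrt (r / n) is sqrt r, which expresses the row sum bound by the coherence.
  The columns are unit vectors, so \<open>V\<close> is nonzero.\<close>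

lemma coherence_bounds:
  fixes V :: "real^'r^'n" and W :: "real^'k^'n"
  assumes split: "orthogonal_split V W"
  shows "0 < coherence V"
    and "norm_2inf V = coherence V * sqrt (real CARD('r) / real CARD('n))"
    and "norm_inf (W ** transpose W) \<le> 1 + coherence V * sqrt (real CARD('r))"
proof -
  have "norm (V *v axis k (1 :: real)) = 1" for k
    by (simp add: norm_orthonormal_mult[OF orthogonal_splitD(1)[OF split]])
  then have "V \<noteq> 0" by auto
  then show "0 < coherence V"
    and mu: "norm_2inf V = coherence V * sqrt (real CARD('r) / real CARD('n))"
    by (rule norm_2inf_eq_coherence)+
  have "sqrt (real CARD('n)) * norm_2inf V = coherence V * sqrt (real CARD('r))"
    unfolding mu by (simp add: real_sqrt_divide)
  then show "norm_inf (W ** transpose W) \<le> 1 + coherence V * sqrt (real CARD('r))"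
    using norm_inf_complement_le[OF split] by simp
qed

theorem proposition1:
  fixes A :: "real^'n^'n"
    and V :: "real^('r::{finite,linorder})^'n"
    and V_perp :: "real^('k::{finite,linorder})^'n"
    and lam :: "'r \<Rightarrow> real" and lam_perp :: "'k \<Rightarrow> real"
    and \<mu> C d0 lam_r lam_r1 n r :: real
    and Q0 :: "real^('r::{finite,linorder})^'n" and Q :: "nat \<Rightarrow> real^('r::{finite,linorder})^'n"
  assumes n: "n = real CARD('n)" and r: "r = real CARD('r)"
    and card: "CARD('n) = CARD('r) + CARD('k)"
    and sym: "transpose A = A"
    and decomp: "A = V ** diag_matrix lam ** transpose V
                   + V_perp ** diag_matrix lam_perp ** transpose V_perp"
    and orth: "transpose (hcat V V_perp) ** hcat V V_perp = mat 1"
              "hcat V V_perp ** transpose (hcat V V_perp) = mat 1"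
    and lam_r: "lam_r = lam (Max UNIV)" and lam_r1: "lam_r1 = lam_perp (Min UNIV)"
    and order: "antimono lam" "lam_r > lam_r1" "antimono lam_perp"
    and gap: "Min (range (\<lambda>i. \<bar>lam i\<bar>)) > Max (range (\<lambda>k. \<bar>lam_perp k\<bar>))"
    and mu: "\<mu> = coherence V"
    and C: "\<And>t::nat. t \<ge> 1 \<Longrightarrow>
              norm_inf (V_perp ** matrix_power (diag_matrix lam_perp) t ** transpose V_perp)
                \<le> C * lam_r1 ^ t * norm_inf (V_perp ** transpose V_perp)"
    and Q0: "Q0 \<in> orthonormal_columns"
    and d0: "d0 = spectral_norm (transpose Q0 ** V_perp)" "d0 < 1"
    and iter: "subspace_iteration A Q0 Q"
  shows "d0 = dist2 Q0 V \<and>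
         (\<forall>t\<ge>1. dist_2inf (Q t) V \<le> (lam_r1 / lam_r) ^ t *
           (\<mu> * sqrt (2 * r / n) * (d0 / sqrt (1 - d0\<^sup>2))
            + C * (1 + \<mu> * sqrt r) / sqrt (1 - d0\<^sup>2) * dist_2inf Q0 V))"
proof (intro conjI allI impI)
  have split: "orthogonal_split V V_perp" using orth by (rule hcat_orthogonal_split)
  show "d0 = dist2 Q0 V" using dist2_eq_spectral_norm[OF split Q0] d0 by simp
  have lam_ge: "lam_r \<le> lam i" for i
    unfolding lam_r by (rule antimonoD[OF order(1)]) simp
  \<comment> \<open>lam_r <= 0 would make lam_r1 < lam_r the larger one in absolute value, against
    the gap.\<close>
  have "Min (range (\<lambda>i. \<bar>lam i\<bar>)) \<le> \<bar>lam_r\<bar>" unfolding lam_r by (rule Min_le) auto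
  moreover have "\<bar>lam_r1\<bar> \<le> Max (range (\<lambda>k. \<bar>lam_perp k\<bar>))" unfolding lam_r1 by (rule Max_ge) auto
  ultimately have lam_r_pos: "0 < lam_r" using gap order(2) by linarith
  \<comment> \<open>Here \<open>j\<close> is the first index. The order of the eigenvalues bounds
    \<open>lam_perp\<close> only from above by lam_r1; this bounds the absolute values.\<close>
  note perp = row_sum_powers_dominate_eigenvalues[OF split C lam_r1[symmetric]]
  note coh = coherence_bounds[OF split, folded mu r n]

  fix t :: nat
  assume t: "1 \<le> t"
  define G where "G = norm_inf (V_perp ** matrix_power (diag_matrix lam_perp) t ** transpose V_perp)"
  define c where "c = sqrt (1 - d0\<^sup>2)"
  define q where "q = lam_r1 ^ t / lam_r ^ t"
  have d0_nonneg: "0 \<le> d0" by (simp add: d0 spectral_norm_nonneg)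
  then have c: "0 < c" using d0 by (simp add: c_def abs_square_less_1)
  have q: "0 \<le> q" using lam_r_pos perp(1) by (simp add: q_def)
  \<comment> \<open>Enlarging the last factor requires C lam_r1^t >= 0, the third fact in
    \<open>perp\<close>.\<close>
  have "G \<le> C * lam_r1 ^ t * (1 + \<mu> * sqrt r)"
    unfolding G_def by (rule order_trans[OF C[OF t] mult_left_mono[OF coh(3) perp(3)[OF _ t]]])
  then have G: "G / (lam_r ^ t * c) \<le> q * (C * (1 + \<mu> * sqrt r) / c)"
    using lam_r_pos c by (simp add: q_def field_simps)
  \<comment> \<open>The argument yields sqrt (r / n); the 2 under the root only weakens it to the
    stated form.\<close>
  have V: "norm_2inf V \<le> \<mu> * sqrt (2 * r / n)"
    unfolding coh(2) using coh(1) by (simp add: r n divide_right_mono)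
  have dist_nonneg: "0 \<le> dist_2inf Q0 V" by (rule dist_2inf_greatest) (rule norm_2inf_nonneg)
  have "dist_2inf (Q t) V \<le> norm_2inf V * (q * (d0 / c)) + G / (lam_r ^ t * c) * dist_2inf Q0 V"
    unfolding q_def c_def G_def
    by (rule subspace_iteration_dist_2inf_le[OF split decomp lam_ge lam_r_pos perp(2,1) Q0 d0 iter t])
  also have "\<dots> \<le> \<mu> * sqrt (2 * r / n) * (q * (d0 / c))
      + q * (C * (1 + \<mu> * sqrt r) / c) * dist_2inf Q0 V"
    using q d0_nonneg c by (intro add_mono mult_right_mono V G dist_nonneg) auto
  also have "\<dots> = q * (\<mu> * sqrt (2 * r / n) * (d0 / c)
      + C * (1 + \<mu> * sqrt r) / c * dist_2inf Q0 V)"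
    by (simp add: algebra_simps)
  finally show "dist_2inf (Q t) V \<le> (lam_r1 / lam_r) ^ t *
      (\<mu> * sqrt (2 * r / n) * (d0 / sqrt (1 - d0\<^sup>2))
       + C * (1 + \<mu> * sqrt r) / sqrt (1 - d0\<^sup>2) * dist_2inf Q0 V)"
    by (simp only: q_def c_def power_divide)
qed

end
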